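(* Let $k\geq 5$ be an integer and let $DLG(1,2)$ denote the double loop graph of order $k$. Then its inducibility satisfies $$\mathcal{I}(DLG(1,2))\leq \dfrac{27\,k!}{k^{k}}.$$
   Context: All graphs are finite and simple. For an integer $k\ge 5$, the double loop graph $DLG(1,2)$ of order $k$ has as vertices the integers modulo $k$, with each vertex $i$ joined to the four vertices $i\pm 1 \pmod{k}$ and $i\pm 2\pmod{k}$. For a graph $H$ of order $k$ and a graph $G$ of order $n\geq k$, let $\mathcal{P}(H,G)$ be the number of $k$-element subsets of $V(G)$ that induce a subgraph isomorphic to $H$. Let $\mathcal{P}(H,n)$ be the maximum of $\mathcal{P}(H,G)$ over all graphs $G$ of order $n$, and let $\mathcal{I}(H,n)=\mathcal{P}(H,n)/\binom{n}{k}$. The sequence $\mathcal{I}(H,n)$ is non-increasing in $n$ and bounded below by $0$; the inducibility of $H$ is $\mathcal{I}(H)=\lim_{n\to\infty}\mathcal{I}(H,n)$. *)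

theory Defs
  imports
    Complex_Main
    "HOL-Number_Theory.Cong"
    "Graph_Theory.Digraph_Isomorphism"
    "Graph_Theory.Pair_Digraph"
begin

text \<open>
  A finite simple graph is a \<^locale>\<open>pair_graph\<close>: a finite vertex set with a symmetric,
  irreflexive set of arcs, each undirected edge being represented by its two orientations.
\<close>

definition double_loop_graph :: "nat \<Rightarrow> int pair_pre_digraph" where
  "double_loop_graph k =
     \<lparr> pverts = {0..<int k},
       parcs = {(i, j). i \<in> {0..<int k} \<and> j \<in> {0..<int k} \<and>
                  (\<exists>d\<in>{1, 2}. [j = i + d] (mod int k) \<or> [j = i - d] (mod int k))} \<rparr>"

definition induced_copies :: "'b pair_pre_digraph \<Rightarrow> 'a pair_pre_digraph \<Rightarrow> 'a set set" where
  "induced_copies H G =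
     {S. S \<subseteq> pverts G \<and> card S = card (pverts H) \<and> digraph_iso (with_proj G \<restriction> S) (with_proj H)}"

definition count_induced :: "'b pair_pre_digraph \<Rightarrow> 'a pair_pre_digraph \<Rightarrow> nat" where
  "count_induced H G = card (induced_copies H G)"

text \<open>
  Every finite graph is isomorphic to one whose vertices are natural numbers, so it is enough
  to let \<open>G\<close> range over the latter.
\<close>

definition max_induced :: "'b pair_pre_digraph \<Rightarrow> nat \<Rightarrow> nat" where
  "max_induced H n =
     Max {count_induced H G | G :: nat pair_pre_digraph. pair_graph G \<and> card (pverts G) = n}"

definition inducibility_at :: "'b pair_pre_digraph \<Rightarrow> nat \<Rightarrow> real" where
  "inducibility_at H n = real (max_induced H n) / real (n choose card (pverts H))"

definition inducibility :: "'b pair_pre_digraph \<Rightarrow> real" where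
  "inducibility H = lim (inducibility_at H)"


text \<open>
  The facts below justify the use of \<^const>\<open>Max\<close> and \<^const>\<open>lim\<close>, which are unspecified
  on infinite sets and on divergent sequences.
\<close>

lemma pair_graph_double_loop_graph:
  assumes "k \<ge> 5"
  shows "pair_graph (double_loop_graph k)"
proof -
  have sub: "parcs (double_loop_graph k) \<subseteq> {0..<int k} \<times> {0..<int k}"
    by (auto simp: double_loop_graph_def)
  have fin: "finite (parcs (double_loop_graph k))"
    by (rule finite_subset[OF sub]) auto
  have sym: "[i = j + d] (mod int k) \<or> [i = j - d] (mod int k)"
    if "[j = i + d] (mod int k) \<or> [j = i - d] (mod int k)" for i j d :: int
    using that by (auto simp: cong_iff_dvd_diff algebra_simps dvd_diff_commute)
  have noloop: "\<not> [i = i + d] (mod int k) \<and> \<not> [i = i - d] (mod int k)" if "d \<in> {1, 2}" for i d :: int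
    using that assms by (auto simp: cong_iff_dvd_diff dest!: zdvd_imp_le)
  show ?thesis
  proof
    show "symmetric (with_proj (double_loop_graph k))"
      unfolding symmetric_def using sym
      by (auto simp: double_loop_graph_def sym_def)
  qed (use fin noloop in \<open>auto simp: double_loop_graph_def\<close>)
qed

lemma digraph_iso_induced_iff:
  assumes "pair_wf_digraph G" "pair_wf_digraph H"
  shows "digraph_iso (with_proj G \<restriction> S) (with_proj H) \<longleftrightarrow>
    (\<exists>f. bij_betw f S (pverts H) \<and>
         (\<forall>u\<in>S. \<forall>v\<in>S. (u, v) \<in> parcs G \<longleftrightarrow> (f u, f v) \<in> parcs H))"
    (is "?L \<longleftrightarrow> ?R")
proof
  assume ?L
  then obtain h where h: "pre_digraph.digraph_isomorphism (with_proj G \<restriction> S) h"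
    and H: "with_proj H = app_iso h (with_proj G \<restriction> S)"
    unfolding digraph_iso_def by blast
  let ?f = "iso_verts h"
  from h have inj: "inj_on ?f S"
    by (simp add: pre_digraph.digraph_isomorphism_def)
  have V: "pverts H = ?f ` S" using arg_cong[OF H, of verts] by simp
  have tl: "iso_tail h = fst" and hd: "iso_head h = snd"
    using arg_cong[OF H, of tail] arg_cong[OF H, of head] by simp_all
  have A: "parcs H = iso_arcs h ` {e \<in> parcs G. fst e \<in> S \<and> snd e \<in> S}"
    using arg_cong[OF H, of arcs] by simp
  have ha: "iso_arcs h e = (?f (fst e), ?f (snd e))" if "e \<in> parcs G" "fst e \<in> S" "snd e \<in> S" for e
    using h that unfolding pre_digraph.digraph_isomorphism_def tl hd by (cases e) (auto simp: prod_eq_iff)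
  have "(u, v) \<in> parcs G \<longleftrightarrow> (?f u, ?f v) \<in> parcs H" if uv: "u \<in> S" "v \<in> S" for u v
  proof
    assume "(u, v) \<in> parcs G"
    then show "(?f u, ?f v) \<in> parcs H"
      unfolding A using ha[of "(u, v)"] uv by (intro image_eqI[of _ _ "(u, v)"]) auto
  next
    assume "(?f u, ?f v) \<in> parcs H"
    then obtain e where e: "e \<in> parcs G" "fst e \<in> S" "snd e \<in> S" "(?f u, ?f v) = iso_arcs h e"
      unfolding A by auto
    then have "fst e = u" "snd e = v"
      using ha[OF e(1-3)] inj uv by (auto dest: inj_onD)
    with e(1) show "(u, v) \<in> parcs G" by auto
  qed
  with inj V show ?R by (auto simp: bij_betw_def)
next
  assume ?R
  then obtain f where bij: "bij_betw f S (pverts H)"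
    and f: "\<And>u v. u \<in> S \<Longrightarrow> v \<in> S \<Longrightarrow> (u, v) \<in> parcs G \<longleftrightarrow> (f u, f v) \<in> parcs H"
    by blast
  interpret H: pair_wf_digraph H by fact
  let ?h = "\<lparr> iso_verts = f, iso_arcs = map_prod f f, iso_head = snd, iso_tail = fst \<rparr>"
  let ?A = "{e \<in> parcs G. fst e \<in> S \<and> snd e \<in> S}"
  have wf: "wf_digraph (with_proj G \<restriction> S)" by unfold_locales auto
  have inj: "inj_on f S" and im: "f ` S = pverts H" using bij by (auto simp: bij_betw_def)
  have "inj_on (map_prod f f) ?A"
    using inj by (auto simp: inj_on_def)
  with wf inj have iso: "pre_digraph.digraph_isomorphism (with_proj G \<restriction> S) ?h"
    by (simp add: pre_digraph.digraph_isomorphism_def)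
  have "map_prod f f ` ?A = parcs H"
  proof (intro subset_antisym subsetI)
    fix e assume "e \<in> parcs H"
    moreover then have "fst e \<in> f ` S" "snd e \<in> f ` S"
      unfolding im by (auto dest: H.arc_fst_in_verts H.arc_snd_in_verts)
    ultimately obtain u v where "u \<in> S" "v \<in> S" "e = (f u, f v)" "(f u, f v) \<in> parcs H"
      by (metis imageE prod.collapse)
    then show "e \<in> map_prod f f ` ?A"
      using f by (intro image_eqI[of _ _ "(u, v)"]) auto
  qed (use f in auto)
  with im have "with_proj H = app_iso ?h (with_proj G \<restriction> S)"
    by (simp add: app_iso_def with_proj_def)
  with iso show ?L unfolding digraph_iso_def by blast
qed

lemma finite_induced_copies: "finite (pverts G) \<Longrightarrow> finite (induced_copies H G)"
  unfolding induced_copies_def by (rule finite_subset[of _ "Pow (pverts G)"]) auto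

lemma count_induced_le:
  assumes "finite (pverts G)"
  shows "count_induced H G \<le> card (pverts G) choose card (pverts H)"
proof -
  have "count_induced H G \<le> card {S. S \<subseteq> pverts G \<and> card S = card (pverts H)}"
    unfolding count_induced_def induced_copies_def using assms by (intro card_mono) auto
  then show ?thesis using n_subsets[OF assms] by simp
qed

lemma
  fixes H :: "'b pair_pre_digraph"
  defines "V \<equiv> \<lambda>n. {count_induced H G | G :: nat pair_pre_digraph. pair_graph G \<and> card (pverts G) = n}"
  shows finite_count_induced_values: "finite (V n)"
    and count_induced_values_nonempty: "V n \<noteq> {}"
proof -
  have "x \<le> n choose card (pverts H)" if "x \<in> V n" for x
  proof -
    from that obtain G :: "nat pair_pre_digraph"
      where G: "x = count_induced H G" "pair_graph G" "card (pverts G) = n"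
      unfolding V_def by blast
    interpret pair_graph G by (fact G(2))
    show ?thesis using count_induced_le[of G H] G pair_finite_verts by simp
  qed
  then show "finite (V n)" by (meson atMost_iff finite_atMost finite_subset subsetI)
  have "pair_graph \<lparr> pverts = {..<n}, parcs = {} \<rparr>"
    by unfold_locales (auto simp: symmetric_def sym_def)
  then show "V n \<noteq> {}" unfolding V_def by force
qed

lemma count_induced_le_max_induced:
  fixes G :: "nat pair_pre_digraph"
  assumes "pair_graph G" "card (pverts G) = n"
  shows "count_induced H G \<le> max_induced H n"
  unfolding max_induced_def using assms
  by (intro Max_ge finite_count_induced_values) blast

lemma max_induced_attained:
  fixes H :: "'b pair_pre_digraph"
  obtains G :: "nat pair_pre_digraph"
  where "pair_graph G" "card (pverts G) = n" "count_induced H G = max_induced H n"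
  using Max_in[OF finite_count_induced_values[of H n] count_induced_values_nonempty[of H n]]
  unfolding max_induced_def by auto

lemma max_induced_Suc_le:
  assumes kn: "card (pverts H) \<le> n"
  shows "(Suc n - card (pverts H)) * max_induced H (Suc n) \<le> Suc n * max_induced H n"
proof -
  let ?k = "card (pverts H)"
  obtain G :: "nat pair_pre_digraph" where G: "pair_graph G" "card (pverts G) = Suc n"
    and eq: "count_induced H G = max_induced H (Suc n)"
    by (rule max_induced_attained)
  interpret pair_graph G by (fact G(1))
  let ?V = "pverts G"
  define D where "D v = \<lparr> pverts = ?V - {v}, parcs = {e \<in> parcs G. fst e \<noteq> v \<and> snd e \<noteq> v} \<rparr>" for v
  have D: "pair_graph (D v)" for v
  proof
    show "symmetric (with_proj (D v))"
      using pair_sym_arcs by (auto simp: D_def symmetric_def sym_def)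
  qed (use pair_finite_verts pair_finite_arcs pair_no_loops in
        \<open>auto simp: D_def dest: wellformed'\<close>)
  have restr: "with_proj (D v) \<restriction> S = with_proj G \<restriction> S" if "v \<notin> S" for v S
    using that by (auto simp: induce_subgraph_def D_def)
  have copies: "induced_copies H (D v) = {S \<in> induced_copies H G. v \<notin> S}" for v
  proof -
    have "(S \<subseteq> pverts (D v)) = (S \<subseteq> ?V \<and> v \<notin> S)" for S by (auto simp: D_def)
    then show ?thesis
      unfolding induced_copies_def using restr[of v] by auto
  qed
  have finC: "finite (induced_copies H G)"
    by (rule finite_induced_copies) (rule pair_finite_verts)
  have "(Suc n - ?k) * max_induced H (Suc n) = (\<Sum>S\<in>induced_copies H G. card {v \<in> ?V. v \<notin> S})"
  proof -
    have "card {v \<in> ?V. v \<notin> S} = Suc n - ?k" if "S \<in> induced_copies H G" for S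
    proof -
      have S: "S \<subseteq> ?V" "card S = ?k" using that by (auto simp: induced_copies_def)
      have "{v \<in> ?V. v \<notin> S} = ?V - S" by auto
      then show ?thesis
        using S G(2) pair_finite_verts by (simp add: card_Diff_subset finite_subset)
    qed
    then show ?thesis using eq by (simp add: count_induced_def)
  qed
  also have "\<dots> = (\<Sum>v\<in>?V. card {S \<in> induced_copies H G. v \<notin> S})"
    by (rule sum_multicount_gen[symmetric]) (use finC pair_finite_verts in auto)
  also have "\<dots> = (\<Sum>v\<in>?V. count_induced H (D v))"
    by (simp add: copies count_induced_def)
  also have "\<dots> \<le> (\<Sum>v\<in>?V. max_induced H n)"
    using G(2) pair_finite_verts
    by (intro sum_mono count_induced_le_max_induced D) (simp add: D_def)
  also have "\<dots> = Suc n * max_induced H n" using G(2) by simp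
  finally show ?thesis .
qed

lemma inducibility_at_Suc_le:
  assumes "card (pverts H) \<le> n"
  shows "inducibility_at H (Suc n) \<le> inducibility_at H n"
proof -
  let ?k = "card (pverts H)"
  have pos: "0 < n choose ?k" "0 < Suc n choose ?k" using assms by simp_all
  have bin: "(Suc n - ?k) * (Suc n choose ?k) = Suc n * (n choose ?k)"
    using binomial_absorb_comp[of "Suc n" ?k] by simp
  have "(Suc n - ?k) * (max_induced H (Suc n) * (n choose ?k)) \<le>
        Suc n * max_induced H n * (n choose ?k)"
    using mult_right_mono[OF max_induced_Suc_le[OF assms], of "n choose ?k"] by (simp add: mult.assoc)
  also have "\<dots> = (Suc n - ?k) * (max_induced H n * (Suc n choose ?k))"
    using bin by (metis mult.assoc mult.left_commute)
  finally have "max_induced H (Suc n) * (n choose ?k) \<le> max_induced H n * (Suc n choose ?k)"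
    using assms by simp
  then have "real (max_induced H (Suc n)) * real (n choose ?k)
             \<le> real (max_induced H n) * real (Suc n choose ?k)"
    by (simp only: of_nat_mult[symmetric] of_nat_le_iff)
  then show ?thesis
    unfolding inducibility_at_def using pos by (simp only: pos_divide_le_eq pos_le_divide_eq times_divide_eq_left of_nat_0_less_iff)
qed

lemma inducibility_at_LIMSEQ: "inducibility_at H \<longlonglongrightarrow> inducibility H"
proof -
  let ?k = "card (pverts H)"
  let ?f = "\<lambda>n. inducibility_at H (n + ?k)"
  have "decseq ?f" by (intro decseq_SucI) (use inducibility_at_Suc_le[of H] in simp)
  moreover have "0 \<le> ?f n" for n by (simp add: inducibility_at_def)
  ultimately have "convergent ?f" by (metis decseq_convergent convergentI)
  then have "convergent (inducibility_at H)" by (simp only: convergent_ignore_initial_segment)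
  then show ?thesis unfolding inducibility_def by (simp add: convergent_LIMSEQ_iff)
qed

end

theory Submission
  imports Defs "HOL-Analysis.Convex" "HOL-Analysis.Complex_Transcendental"
begin

text \<open>
  Embeddings of a graph \<open>H\<close> of order \<open>k\<close> into a graph \<open>G\<close> of order \<open>n\<close> are built
  greedily: the vertices of \<open>H\<close> are placed in a fixed order, and \<open>A\<^sub>i\<close> is the set of vertices
  of \<open>G\<close> whose adjacencies to the vertices placed so far are those required of the \<open>i\<close>-th
  vertex. If every choice is made uniformly at random, a given embedding arises with probability
  \<open>\<Prod>\<^sub>i 1/|A\<^sub>i|\<close>. These probabilities add up to at most 1, so the number of embeddings is at most
  the largest product \<open>\<Prod>\<^sub>i |A\<^sub>i|\<close> that an embedding produces (\<open>card_greedy_le\<close>).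

  Such a product is small because a vertex \<open>v\<close> of \<open>G\<close> belongs to few of the sets \<open>A\<^sub>i\<close>. Suppose that
  positive weights \<open>c\<^sub>1, \<dots>, c\<^sub>m\<close> with \<open>m = k - 1\<close> are such that, whatever the adjacencies of \<open>v\<close> to
  the placed vertices, the weights of the sets \<open>A\<^sub>i\<close> containing \<open>v\<close> sum to at most 1. Then
  \<open>\<Sum>\<^sub>i c\<^sub>i |A\<^sub>i| \<le> n\<close>, and the inequality between arithmetic and geometric means gives
  \<open>\<Prod>\<^sub>i |A\<^sub>i| \<le> n (n/m)^m / \<Prod>\<^sub>i c\<^sub>i\<close>, where the extra factor \<open>n\<close> comes from the first vertex. Every
  induced copy of \<open>H\<close> is the image of as many embeddings as \<open>H\<close> has automorphisms. Dividing by
  that number and by \<open>n choose k\<close> and letting \<open>n\<close> grow yields \<open>inducibility_le_of_weights\<close>.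

  For the double loop graph with \<open>k \<ge> 7\<close> the vertices are placed in the order
  \<open>0, 2, 1, 3, 4, \<dots>, k - 1\<close>. Apart from \<open>A\<^sub>1\<close>, the neighbourhood of the vertex placed at \<open>0\<close>, the
  sets \<open>A\<^sub>i\<close> are pairwise disjoint (\<open>earlier_neighbour_differs\<close>), and only those for the remaining
  neighbours \<open>1, k - 2, k - 1\<close> of \<open>0\<close> meet \<open>A\<^sub>1\<close>. So weight \<open>1/4\<close> for \<open>A\<^sub>1\<close>, \<open>3/4\<close> for these three and
  \<open>1\<close> for all others is admissible. With the \<open>k\<close> rotations as automorphisms the bound becomes
  \<open>(256/27) (k/(k-1))^(k-1) k!/k^k\<close>, and \<open>(256/27) e < 27\<close>.

  Two small orders are different. For \<open>k = 5\<close> the claimed bound exceeds 1. For \<open>k = 6\<close> the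
  vertices \<open>4\<close> and \<open>2\<close> become adjacent and destroy the disjointness; the weights are then worse, but
  the graph is the octahedron, whose many additional automorphisms more than compensate.
\<close>

section \<open>Counting sequences of greedy choices\<close>

definition greedy :: "('a list \<Rightarrow> 'a set) \<Rightarrow> nat \<Rightarrow> 'a list set" where
  "greedy A k = {xs. length xs = k \<and> (\<forall>i<k. xs ! i \<in> A (take i xs))}"

lemma greedy_Suc: "greedy A (Suc k) = (\<lambda>(xs, v). xs @ [v]) ` (SIGMA xs:greedy A k. A xs)"
proof (intro subset_antisym subsetI)
  fix ys assume ys: "ys \<in> greedy A (Suc k)"
  then have "ys \<noteq> []" by (auto simp: greedy_def)
  then obtain xs v where ys_eq: "ys = xs @ [v]" by (metis rev_exhaust)
  have len: "length xs = k" using ys ys_eq by (simp add: greedy_def)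
  have nth: "ys ! i \<in> A (take i ys)" if "i < Suc k" for i using ys that by (simp add: greedy_def)
  have "v \<in> A xs" using nth[of k] len by (simp add: ys_eq nth_append)
  moreover have "xs ! i \<in> A (take i xs)" if "i < k" for i
    using nth[of i] that len by (simp add: ys_eq nth_append)
  ultimately show "ys \<in> (\<lambda>(xs, v). xs @ [v]) ` (SIGMA xs:greedy A k. A xs)"
    using len ys_eq by (auto simp: greedy_def)
next
  fix ys assume "ys \<in> (\<lambda>(xs, v). xs @ [v]) ` (SIGMA xs:greedy A k. A xs)"
  then show "ys \<in> greedy A (Suc k)"
    by (auto simp: greedy_def less_Suc_eq nth_append)
qed

text \<open>
  The summand is the probability that uniform random choices from the candidate sets produce
  \<open>xs\<close>. The sum can be less than 1 because a process that meets an empty candidate set stops early.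
\<close>

lemma greedy_probability:
  assumes fin: "\<And>xs. finite (A xs)"
  shows "finite (greedy A k) \<and> (\<Sum>xs\<in>greedy A k. \<Prod>i<k. 1 / real (card (A (take i xs)))) \<le> 1"
proof (induction k)
  case 0
  then show ?case by (auto simp: greedy_def)
next
  case (Suc k)
  let ?w = "\<lambda>k xs. \<Prod>i<k. 1 / real (card (A (take i xs)))"
  let ?app = "\<lambda>(xs, v). xs @ [v] :: 'a list"
  have fin_Suc: "finite (greedy A (Suc k))"
    unfolding greedy_Suc using Suc fin by auto
  have inj: "inj_on ?app (SIGMA xs:greedy A k. A xs)" by (auto simp: inj_on_def)
  have "(\<Sum>xs\<in>greedy A (Suc k). ?w (Suc k) xs)
        = (\<Sum>(xs, v)\<in>(SIGMA xs:greedy A k. A xs). ?w (Suc k) (xs @ [v]))"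
    unfolding greedy_Suc by (subst sum.reindex[OF inj]) (simp add: case_prod_unfold)
  also have "\<dots> = (\<Sum>xs\<in>greedy A k. \<Sum>v\<in>A xs. ?w (Suc k) (xs @ [v]))"
    using Suc fin by (subst sum.Sigma) auto
  also have "\<dots> \<le> (\<Sum>xs\<in>greedy A k. ?w k xs)"
  proof (rule sum_mono)
    fix xs assume "xs \<in> greedy A k"
    then have len: "length xs = k" by (simp add: greedy_def)
    have "(\<Sum>v\<in>A xs. ?w (Suc k) (xs @ [v])) = (\<Sum>v\<in>A xs. ?w k xs * (1 / real (card (A xs))))"
      using len by (intro sum.cong) (auto intro!: prod.cong)
    also have "\<dots> = ?w k xs * (real (card (A xs)) * (1 / real (card (A xs))))" by simp
    also have "\<dots> \<le> ?w k xs * 1"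
      by (intro mult_left_mono prod_nonneg) auto
    finally show "(\<Sum>v\<in>A xs. ?w (Suc k) (xs @ [v])) \<le> ?w k xs" by simp
  qed
  also have "\<dots> \<le> 1" using Suc by simp
  finally show ?case using fin_Suc by simp
qed

lemma card_greedy_le:
  assumes fin: "\<And>xs. finite (A xs)" and M: "0 \<le> M"
    and bound: "\<And>xs. xs \<in> greedy A k \<Longrightarrow> (\<Prod>i<k. real (card (A (take i xs)))) \<le> M"
  shows "real (card (greedy A k)) \<le> M"
proof (cases "greedy A k = {}")
  case False
  have pos: "0 < (\<Prod>i<k. real (card (A (take i xs))))" if "xs \<in> greedy A k" for xs
    using that fin by (intro prod_pos) (auto simp: greedy_def card_gt_0_iff)
  then have "0 < M" using False bound by (meson ex_in_conv less_le_trans)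
  have "real (card (greedy A k)) * (1 / M) = (\<Sum>xs\<in>greedy A k. 1 / M)" by simp
  also have "\<dots> \<le> (\<Sum>xs\<in>greedy A k. \<Prod>i<k. 1 / real (card (A (take i xs))))"
  proof (rule sum_mono)
    fix xs assume xs: "xs \<in> greedy A k"
    show "1 / M \<le> (\<Prod>i<k. 1 / real (card (A (take i xs))))"
      using bound[OF xs] pos[OF xs] \<open>0 < M\<close> by (simp add: prod_dividef frac_le)
  qed
  also have "\<dots> \<le> 1" using greedy_probability[of A, OF fin] by blast
  finally show ?thesis using \<open>0 < M\<close> by (simp add: field_simps)
qed (use M in simp)

text \<open>
  The arithmetic and geometric means are compared for the numbers \<open>c i * card (B i)\<close>; their sum
  counts each \<open>v \<in> V\<close> with the total weight of the sets that contain it.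
\<close>

lemma weighted_prod_card_le:
  fixes c :: "'i \<Rightarrow> real"
  assumes "finite V" "finite I" "I \<noteq> {}"
    and B: "\<And>i. i \<in> I \<Longrightarrow> B i \<subseteq> V" and c: "\<And>i. i \<in> I \<Longrightarrow> 0 \<le> c i"
    and le1: "\<And>v. v \<in> V \<Longrightarrow> (\<Sum>i | i \<in> I \<and> v \<in> B i. c i) \<le> 1"
  shows "(\<Prod>i\<in>I. c i) * (\<Prod>i\<in>I. real (card (B i))) \<le> (real (card V) / real (card I)) ^ card I"
proof -
  let ?x = "\<lambda>i. c i * real (card (B i))"
  have pos: "0 \<le> prod ?x I" by (intro prod_nonneg) (simp add: c)
  have sum_nn: "0 \<le> (\<Sum>i\<in>I. ?x i)" by (intro sum_nonneg) (simp add: c)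
  have cI: "card I > 0" using assms by (simp add: card_gt_0_iff)
  have "(\<Sum>i\<in>I. ?x i) = (\<Sum>i\<in>I. \<Sum>v\<in>V. if v \<in> B i then c i else 0)"
  proof (rule sum.cong[OF refl])
    fix i assume i: "i \<in> I"
    have "(\<Sum>v\<in>V. if v \<in> B i then c i else 0) = (\<Sum>v\<in>V \<inter> B i. c i)"
      by (rule sum.inter_restrict[OF \<open>finite V\<close>, symmetric])
    also have "V \<inter> B i = B i" using B[OF i] by auto
    finally show "?x i = (\<Sum>v\<in>V. if v \<in> B i then c i else 0)" by simp
  qed
  also have "\<dots> = (\<Sum>v\<in>V. \<Sum>i | i \<in> I \<and> v \<in> B i. c i)"
    by (subst sum.swap) (simp add: sum.inter_filter[OF \<open>finite I\<close>])
  also have "\<dots> \<le> (\<Sum>v\<in>V. 1)" by (intro sum_mono le1)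
  finally have sum_le: "(\<Sum>i\<in>I. ?x i) \<le> real (card V)" by simp
  have "(\<Prod>i\<in>I. c i) * (\<Prod>i\<in>I. real (card (B i))) = prod ?x I"
    by (simp add: prod.distrib)
  also have "\<dots> = (prod ?x I powr (1 / card I)) ^ card I"
    using pos cI by (cases "prod ?x I = 0") (simp_all add: powr_powr flip: powr_realpow)
  also have "\<dots> \<le> (\<Sum>i\<in>I. ?x i / card I) ^ card I"
    by (intro power_mono arith_geom_mean assms) (simp_all add: c)
  also have "\<dots> \<le> (real (card V) / real (card I)) ^ card I"
    using sum_le sum_nn by (intro power_mono) (simp_all add: divide_right_mono flip: sum_divide_distrib)
  finally show ?thesis .
qed

section \<open>Inducibility bounds from weights\<close>

lemma power_over_choose_tendsto_fact:
  "(\<lambda>n. real n ^ k / real (n choose k)) \<longlonglongrightarrow> fact k"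
proof -
  have "(\<lambda>n. (\<Prod>i<k. (real n - real i) / real n)) \<longlonglongrightarrow> (\<Prod>i<k. 1)"
  proof (rule tendsto_prod)
    fix i
    have "(\<lambda>n. 1 - real i * (1 / real n)) \<longlonglongrightarrow> 1 - real i * 0"
      by (intro tendsto_intros lim_1_over_n)
    moreover have "\<forall>\<^sub>F n in sequentially. 1 - real i * (1 / real n) = (real n - real i) / real n"
      using eventually_gt_at_top[of 0] by eventually_elim (simp add: field_simps)
    ultimately show "(\<lambda>n. (real n - real i) / real n) \<longlonglongrightarrow> 1"
      by (auto intro: Lim_transform_eventually)
  qed
  then have "(\<lambda>n. fact k / (\<Prod>i<k. (real n - real i) / real n)) \<longlonglongrightarrow> fact k / (\<Prod>i<k. 1)"
    by (intro tendsto_divide tendsto_const) auto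
  moreover have "\<forall>\<^sub>F n in sequentially.
      fact k / (\<Prod>i<k. (real n - real i) / real n) = real n ^ k / real (n choose k)"
    using eventually_gt_at_top[of k]
  proof eventually_elim
    case (elim n)
    have "(\<Prod>i<k. real n - real i) = fact k * real (n choose k)"
      by (simp add: binomial_gbinomial gbinomial_prod_rev atLeast0LessThan)
    then show ?case by (simp add: prod_dividef)
  qed
  ultimately show ?thesis by (auto intro: Lim_transform_eventually)
qed

text \<open>
  The list \<open>hs\<close> enumerates the vertices of \<open>H\<close> in the order in which they are placed; an embedding
  is recorded as the list of their images in this order. For \<open>G = H\<close> the embeddings correspond to
  the automorphisms of \<open>H\<close>.
\<close>

definition embeddings :: "'b list \<Rightarrow> 'b pair_pre_digraph \<Rightarrow> 'a pair_pre_digraph \<Rightarrow> 'a list set" where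
  "embeddings hs H G = {xs. length xs = length hs \<and> distinct xs \<and> set xs \<subseteq> pverts G \<and>
     (\<forall>i<length hs. \<forall>j<length hs. (xs ! i, xs ! j) \<in> parcs G \<longleftrightarrow> (hs ! i, hs ! j) \<in> parcs H)}"

lemma finite_embeddings: "finite (pverts G) \<Longrightarrow> finite (embeddings hs H G)"
  by (rule finite_subset[OF _ finite_lists_length_eq[of "pverts G" "length hs"]])
    (auto simp: embeddings_def)

text \<open>
  An isomorphism from \<open>H\<close> onto a copy, composed with each automorphism of \<open>H\<close>, gives distinct
  embeddings with that copy as image, and different copies have different images.
\<close>

lemma count_induced_mult_automorphisms_le:
  assumes "pair_wf_digraph G" "pair_wf_digraph H" "finite (pverts G)"
    and hs: "length hs = card (pverts H)"
  shows "count_induced H G * card (embeddings hs H H) \<le> card (embeddings hs H G)"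
proof -
  let ?k = "length hs"
  let ?E = "\<lambda>S. {xs \<in> embeddings hs H G. set xs = S}"
  have finE: "finite (embeddings hs H G)" using assms by (intro finite_embeddings)
  have "card (embeddings hs H H) \<le> card (?E S)" if S: "S \<in> induced_copies H G" for S
  proof -
    have SG: "S \<subseteq> pverts G" and cardS: "card S = card (pverts H)" using S by (auto simp: induced_copies_def)
    have "digraph_iso (with_proj G \<restriction> S) (with_proj H)" using S by (simp add: induced_copies_def)
    then obtain f where f: "bij_betw f S (pverts H)"
      "\<And>u v. u \<in> S \<Longrightarrow> v \<in> S \<Longrightarrow> (u, v) \<in> parcs G \<longleftrightarrow> (f u, f v) \<in> parcs H"
      unfolding digraph_iso_induced_iff[OF assms(1,2)] by blast
    let ?g = "inv_into S f"
    have g: "bij_betw ?g (pverts H) S" using f(1) by (rule bij_betw_inv_into)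
    have gS: "?g a \<in> S" "f (?g a) = a" if "a \<in> pverts H" for a
      using that f(1) g by (auto simp: bij_betw_def f_inv_into_f inv_into_into)
    have g_arcs: "(?g a, ?g b) \<in> parcs G \<longleftrightarrow> (a, b) \<in> parcs H" if "a \<in> pverts H" "b \<in> pverts H" for a b
      using f(2) gS that by simp
    have "map ?g p \<in> ?E S" if p: "p \<in> embeddings hs H H" for p
    proof -
      have sub: "set p \<subseteq> pverts H" and d: "distinct p" and len: "length p = ?k"
        using p by (auto simp: embeddings_def)
      have "distinct (map ?g p)"
        using d sub g by (auto simp: distinct_map bij_betw_def intro: inj_on_subset)
      moreover have sS: "set (map ?g p) \<subseteq> S" using sub gS by auto
      moreover have "set (map ?g p) = S"
      proof (rule card_subset_eq)
        show "finite S" using SG assms(3) finite_subset by blast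
        show "card (set (map ?g p)) = card S"
          using distinct_card[OF \<open>distinct (map ?g p)\<close>] len hs cardS by simp
      qed (rule sS)
      moreover have "(map ?g p ! i, map ?g p ! j) \<in> parcs G \<longleftrightarrow> (hs ! i, hs ! j) \<in> parcs H"
        if "i < ?k" "j < ?k" for i j
      proof -
        have "p ! i \<in> pverts H" "p ! j \<in> pverts H" using sub len that by auto
        then show ?thesis using p that len g_arcs by (simp add: embeddings_def)
      qed
      ultimately show ?thesis using SG len by (auto simp: embeddings_def)
    qed
    moreover have "inj_on (map ?g) (embeddings hs H H)"
    proof (rule inj_onI)
      fix p q assume pq: "p \<in> embeddings hs H H" "q \<in> embeddings hs H H" "map ?g p = map ?g q"
      have "inj_on ?g (set p \<union> set q)"
        using g pq by (auto simp: bij_betw_def embeddings_def intro: inj_on_subset)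
      then show "p = q" using pq(3) by (simp add: inj_on_map_eq_map)
    qed
    ultimately show ?thesis using finE by (intro card_inj_on_le[where f = "map ?g"]) auto
  qed
  then have "count_induced H G * card (embeddings hs H H) \<le> (\<Sum>S\<in>induced_copies H G. card (?E S))"
    using sum_mono[of "induced_copies H G" "\<lambda>_. card (embeddings hs H H)" "\<lambda>S. card (?E S)"]
    by (simp add: count_induced_def)
  also have "\<dots> = card (\<Union>S\<in>induced_copies H G. ?E S)"
    using finite_induced_copies[OF assms(3)] finE by (intro card_UN_disjoint[symmetric]) auto
  also have "\<dots> \<le> card (embeddings hs H G)" using finE by (intro card_mono) auto
  finally show ?thesis .
qed

text \<open>
  Here \<open>N j\<close> tells whether a vertex of \<open>G\<close> is adjacent to the \<open>j\<close>-th placed vertex, and \<open>R\<close> is the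
  adjacency relation of \<open>H\<close> in the order of placement. A vertex with pattern \<open>N\<close> is a candidate for
  the \<open>i\<close>-th place exactly if \<open>N\<close> fits.
\<close>

definition fits :: "(nat \<Rightarrow> nat \<Rightarrow> bool) \<Rightarrow> (nat \<Rightarrow> bool) \<Rightarrow> nat \<Rightarrow> bool" where
  "fits R N i \<longleftrightarrow> (\<forall>j<i. N j \<longleftrightarrow> R j i)"

text \<open>
  The first vertex is left out of the weighting: every vertex of \<open>G\<close> is a candidate for it, so a
  positive weight there would have to be taken from all later places.
\<close>

lemma card_embeddings_le:
  fixes c :: "nat \<Rightarrow> real"
  assumes fin: "finite (pverts G)" and k: "length hs = Suc m" "m > 0"
    and c: "\<And>i. 0 < c i"
    and weights: "\<And>N. (\<Sum>i | i \<in> {1..m} \<and> fits (\<lambda>j i. (hs ! j, hs ! i) \<in> parcs H) N i. c i) \<le> 1"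
  shows "real (card (embeddings hs H G)) \<le> real (card (pverts G)) ^ Suc m / ((\<Prod>i=1..m. c i) * real m ^ m)"
proof -
  let ?V = "pverts G" and ?R = "\<lambda>j i. (hs ! j, hs ! i) \<in> parcs H"
  define A where "A xs = {v \<in> ?V. fits ?R (\<lambda>j. (xs ! j, v) \<in> parcs G) (length xs)}" for xs
  let ?M = "real (card ?V) ^ Suc m / ((\<Prod>i=1..m. c i) * real m ^ m)"
  have cpos: "0 < (\<Prod>i=1..m. c i)" by (intro prod_pos) (simp add: c)
  have sub: "embeddings hs H G \<subseteq> greedy A (Suc m)"
  proof
    fix xs assume xs: "xs \<in> embeddings hs H G"
    have "xs ! i \<in> A (take i xs)" if "i < Suc m" for i
    proof -
      have "xs ! i \<in> ?V" using xs that k by (auto simp: embeddings_def)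
      then show ?thesis using xs that k by (auto simp: embeddings_def A_def fits_def)
    qed
    then show "xs \<in> greedy A (Suc m)" using xs k by (auto simp: embeddings_def greedy_def)
  qed
  have finA: "finite (A xs)" for xs using fin by (simp add: A_def)
  have "(\<Prod>i<Suc m. real (card (A (take i xs)))) \<le> ?M" if "xs \<in> greedy A (Suc m)" for xs
  proof -
    have len: "length xs = Suc m" using that by (simp add: greedy_def)
    let ?B = "\<lambda>i. A (take i xs)"
    have "(\<Sum>i | i \<in> {1..m} \<and> v \<in> ?B i. c i) \<le> 1" if "v \<in> ?V" for v
    proof -
      have "{i. i \<in> {1..m} \<and> v \<in> ?B i} = {i. i \<in> {1..m} \<and> fits ?R (\<lambda>j. (xs ! j, v) \<in> parcs G) i}"
        using that len by (auto simp: A_def fits_def)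
      then show ?thesis using weights by simp
    qed
    then have "(\<Prod>i=1..m. c i) * (\<Prod>i=1..m. real (card (?B i))) \<le> (real (card ?V) / real m) ^ m"
      using weighted_prod_card_le[of ?V "{1..m}" ?B c] fin c k by (force simp: A_def less_imp_le)
    then have "(\<Prod>i=1..m. real (card (?B i))) \<le> (real (card ?V) / real m) ^ m / (\<Prod>i=1..m. c i)"
      using cpos by (simp add: pos_le_divide_eq mult.commute)
    then have "real (card (A [])) * (\<Prod>i=1..m. real (card (?B i)))
        \<le> real (card ?V) * ((real (card ?V) / real m) ^ m / (\<Prod>i=1..m. c i))"
      using fin by (intro mult_mono prod_nonneg) (auto simp: A_def intro!: card_mono)
    also have "\<dots> = ?M" by (simp add: power_divide mult.commute)
    also have "real (card (A [])) * (\<Prod>i=1..m. real (card (?B i))) = (\<Prod>i<Suc m. real (card (?B i)))"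
      by (subst prod.lessThan_Suc_shift) (simp add: prod.atLeast1_atMost_eq)
    finally show ?thesis .
  qed
  then have "real (card (greedy A (Suc m))) \<le> ?M"
    using finA cpos by (intro card_greedy_le) auto
  moreover have "card (embeddings hs H G) \<le> card (greedy A (Suc m))"
    using sub greedy_probability[of A "Suc m"] finA by (intro card_mono) auto
  ultimately show ?thesis by linarith
qed

text \<open>
  The number \<open>a\<close> is any lower bound for the number of automorphisms, so that it suffices to exhibit
  some of them.
\<close>

theorem inducibility_le_of_weights:
  fixes H :: "'b pair_pre_digraph" and c :: "nat \<Rightarrow> real"
  assumes H: "pair_wf_digraph H" and hs: "length hs = card (pverts H)" "length hs = Suc m" "m > 0"
    and a: "0 < a" "a \<le> card (embeddings hs H H)"
    and c: "\<And>i. 0 < c i"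
    and weights: "\<And>N. (\<Sum>i | i \<in> {1..m} \<and> fits (\<lambda>j i. (hs ! j, hs ! i) \<in> parcs H) N i. c i) \<le> 1"
  shows "inducibility H \<le> fact (Suc m) / (real a * (\<Prod>i=1..m. c i) * real m ^ m)"
proof (rule LIMSEQ_le)
  let ?D = "(\<Prod>i=1..m. c i) * real m ^ m"
  have D: "0 < ?D" using c hs by (intro mult_pos_pos prod_pos) auto
  have aD: "0 < real a * ?D" using a by (intro mult_pos_pos D) simp
  have cardH: "card (pverts H) = Suc m" using hs by simp
  show "inducibility_at H \<longlonglongrightarrow> inducibility H" by (rule inducibility_at_LIMSEQ)
  have "(\<lambda>n. real n ^ Suc m / real (n choose Suc m) / (real a * ?D)) \<longlonglongrightarrow> fact (Suc m) / (real a * ?D)"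
    by (intro tendsto_divide power_over_choose_tendsto_fact tendsto_const) (use aD in linarith)
  then show "(\<lambda>n. real n ^ Suc m / real (n choose Suc m) / (real a * ?D))
      \<longlonglongrightarrow> fact (Suc m) / (real a * (\<Prod>i=1..m. c i) * real m ^ m)"
    by (simp only: mult.assoc)
  have "inducibility_at H n \<le> real n ^ Suc m / real (n choose Suc m) / (real a * ?D)" for n
  proof -
    obtain G :: "nat pair_pre_digraph" where G: "pair_graph G" "card (pverts G) = n"
      and eq: "count_induced H G = max_induced H n"
      by (rule max_induced_attained)
    interpret pair_graph G by (fact G(1))
    have "max_induced H n * a \<le> count_induced H G * card (embeddings hs H H)"
      using a eq by simp
    also have "\<dots> \<le> card (embeddings hs H G)"
      by (rule count_induced_mult_automorphisms_le[OF pair_wf_digraph_axioms H pair_finite_verts hs(1)])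
    finally have "real (max_induced H n) * real a \<le> real (card (embeddings hs H G))"
      by (simp only: of_nat_mult[symmetric] of_nat_le_iff)
    also have "\<dots> \<le> real n ^ Suc m / ?D"
      using card_embeddings_le[OF pair_finite_verts hs(2,3) c weights] G by simp
    finally have "real (max_induced H n) \<le> real n ^ Suc m / ?D / real a"
      by (rule mult_imp_le_div_pos[rotated]) (use a in simp)
    then have "real (max_induced H n) / real (n choose Suc m)
        \<le> real n ^ Suc m / ?D / real a / real (n choose Suc m)"
      by (rule divide_right_mono) simp
    then show ?thesis
      unfolding inducibility_at_def cardH by (simp only: divide_divide_eq_left mult_ac)
  qed
  then show "\<exists>N. \<forall>n\<ge>N. inducibility_at H n \<le> real n ^ Suc m / real (n choose Suc m) / (real a * ?D)"
    by blast
qed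

section \<open>Adjacency in double loop graphs\<close>

lemma cong_add_iff:
  fixes i j d k :: int
  assumes "0 \<le> i" "i < k" "0 \<le> j" "j < k" "0 \<le> d" "d < k"
  shows "[j = i + d] (mod k) \<longleftrightarrow> j = i + d \<or> j + k = i + d"
proof -
  have "(i + d) mod k = (if i + d < k then i + d else i + d - k)"
  proof (cases "i + d < k")
    case False
    have "(i + d) mod k = (i + d - k) mod k" by simp
    also have "\<dots> = i + d - k" using False assms by (intro mod_pos_pos_trivial) auto
    finally show ?thesis using False by simp
  qed (use assms in simp)
  then show ?thesis using assms by (auto simp: cong_def)
qed

lemma double_loop_graph_arc_iff:
  assumes "5 \<le> k" "i < k" "j < k"
  shows "(int i, int j) \<in> parcs (double_loop_graph k) \<longleftrightarrow>
    j = i + 1 \<or> j = i + 2 \<or> i = j + 1 \<or> i = j + 2 \<or>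
    j + k = i + 1 \<or> j + k = i + 2 \<or> i + k = j + 1 \<or> i + k = j + 2"
proof -
  have flip: "[y = x - d] (mod int k) \<longleftrightarrow> [x = y + d] (mod int k)" for x y d
    by (auto simp: cong_iff_dvd_diff algebra_simps dvd_diff_commute)
  have step: "[int y = int x + d] (mod int k) \<longleftrightarrow> y = x + nat d \<or> y + k = x + nat d"
    if "x < k" "y < k" "d \<in> {1, 2}" for x y d
    using that assms by (subst cong_add_iff) auto
  have "(int i, int j) \<in> parcs (double_loop_graph k) \<longleftrightarrow>
    (\<exists>d\<in>{1, 2}. [int j = int i + d] (mod int k) \<or> [int i = int j + d] (mod int k))"
    using assms by (simp add: double_loop_graph_def flip)
  also have "\<dots> \<longleftrightarrow> (\<exists>d\<in>{1, 2::int}. (j = i + nat d \<or> j + k = i + nat d) \<or> (i = j + nat d \<or> i + k = j + nat d))"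
    using assms step by (intro bex_cong) auto
  also have "\<dots> \<longleftrightarrow> j = i + 1 \<or> j = i + 2 \<or> i = j + 1 \<or> i = j + 2 \<or>
    j + k = i + 1 \<or> j + k = i + 2 \<or> i + k = j + 1 \<or> i + k = j + 2" by auto
  finally show ?thesis .
qed

text \<open>
  Exchanging \<open>1\<close> and \<open>2\<close> keeps candidate sets apart. In the natural order one vertex of \<open>G\<close> could be
  a candidate for \<open>1\<close>, for \<open>2\<close> and for \<open>k - 1\<close>, since the first two require no more than adjacency
  to the images of \<open>0\<close> and \<open>1\<close>, which \<open>k - 1\<close> requires as well. When \<open>2\<close> is placed second, the
  candidates for \<open>1\<close> must be adjacent to its image, while for \<open>k \<ge> 7\<close> those for \<open>k - 2\<close> and
  \<open>k - 1\<close> must not.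
\<close>

definition loop_order :: "nat \<Rightarrow> nat" where
  "loop_order i = (if i = 1 then 2 else if i = 2 then 1 else i)"

abbreviation loop_list :: "nat \<Rightarrow> int list" where
  "loop_list k \<equiv> map (\<lambda>i. int (loop_order i)) [0..<k]"

lemma loop_order_less: "3 \<le> k \<Longrightarrow> i < k \<Longrightarrow> loop_order i < k"
  by (simp add: loop_order_def)

lemma loop_order_eq_iff: "loop_order i = loop_order j \<longleftrightarrow> i = j"
  by (auto simp: loop_order_def)

section \<open>Weights for order at least seven\<close>

text \<open>
  No adjacency pattern fits two different places \<open>i < i'\<close>, both at least 2, since some vertex \<open>j\<close>
  placed before both is required to be adjacent to one and not to the other. If \<open>i\<close> and \<open>i'\<close> are
  both in the middle of the order, \<open>j\<close> is the vertex \<open>i - 2\<close> of the graph, which the middle vertex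
  \<open>i'\<close> lies too far behind. A middle vertex is told from a neighbour of \<open>0\<close> by \<open>0\<close>. The three
  remaining neighbours \<open>1\<close>, \<open>k - 2\<close>, \<open>k - 1\<close> of \<open>0\<close> are told apart by the vertices \<open>2\<close> and \<open>1\<close>. Here
  \<open>m = k - 1\<close>.
\<close>

lemma earlier_neighbour_differs:
  assumes m: "6 \<le> m" and i: "2 \<le> i" "i < i'" "i' \<le> m"
  defines "R \<equiv> \<lambda>j i. (int (loop_order j), int (loop_order i)) \<in> parcs (double_loop_graph (Suc m))"
  shows "\<exists>j<i. R j i \<noteq> R j i'"
proof -
  have R: "R x y \<longleftrightarrow> (let a = loop_order x; b = loop_order y in
      b = a + 1 \<or> b = a + 2 \<or> a = b + 1 \<or> a = b + 2 \<or>
      b + m = a \<or> b + m = a + 1 \<or> a + m = b \<or> a + m = b + 1)" if "x \<le> m" "y \<le> m" for x y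
    unfolding R_def Let_def using m that
    by (subst double_loop_graph_arc_iff) (auto simp: loop_order_less)
  note R' = R[unfolded loop_order_def Let_def]
  consider "i = 2" "i' + 2 \<le> m" | "i = 2" "m \<le> i' + 1" | "3 \<le> i" "i' + 2 \<le> m"
    | "3 \<le> i" "i + 2 \<le> m" "m \<le> i' + 1" | "m = i + 1" "i' = m"
    using i by linarith
  then show ?thesis
  proof cases
    case 1
    then have "R 0 i \<noteq> R 0 i'" using i m by (simp add: R')
    then show ?thesis using i by (intro exI[of _ 0]) simp
  next
    case 2
    \<comment> \<open>Index 1 stands for vertex \<open>2\<close>.\<close>
    then have "R 1 i \<noteq> R 1 i'" using i m by (simp add: R')
    then show ?thesis using 2 by (intro exI[of _ 1]) simp
  next
    case 3
    define a where "a = i - 2"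
    have a: "i = a + 2" "1 \<le> a" using 3 by (auto simp: a_def)
    let ?j = "loop_order a"
    have j: "?j < i" "loop_order ?j = a" using a by (auto simp: loop_order_def)
    have fixed: "loop_order i = i" "loop_order i' = i'" using 3 i by (auto simp: loop_order_def)
    have "?j \<le> m" "i \<le> m" "i' \<le> m" using 3 i j by auto
    then have "R ?j i" "\<not> R ?j i'"
      unfolding R[OF \<open>?j \<le> m\<close> \<open>i \<le> m\<close>] R[OF \<open>?j \<le> m\<close> \<open>i' \<le> m\<close>] fixed j(2) Let_def
      using a i 3 by simp_all
    then show ?thesis using j by blast
  next
    case 4
    then have "R 0 i \<noteq> R 0 i'" using i m by (simp add: R') arith
    then show ?thesis using i by (intro exI[of _ 0]) simp
  next
    case 5
    \<comment> \<open>Index 2 stands for vertex \<open>1\<close>.\<close>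
    then have "R 2 i \<noteq> R 2 i'" using i m by (simp add: R')
    then show ?thesis using 5 m by (intro exI[of _ 2]) simp
  qed
qed

text \<open>
  The weights have to satisfy \<open>c 1 + c i \<le> 1\<close> for the three places \<open>i\<close> whose candidate sets meet
  that of place 1, so they maximise \<open>x (1 - x)^3\<close>.
\<close>

definition loop_weight :: "nat \<Rightarrow> nat \<Rightarrow> real" where
  "loop_weight m i = (if i = 1 then 1/4 else if i \<in> {2, m - 1, m} then 3/4 else 1)"

lemma prod_loop_weight:
  assumes "6 \<le> m"
  shows "(\<Prod>i=1..m. loop_weight m i) = 27/256"
proof -
  have "(\<Prod>i=1..m. loop_weight m i) = (\<Prod>i\<in>{1, 2, m - 1, m}. loop_weight m i)"
    using assms by (intro prod.mono_neutral_right) (auto simp: loop_weight_def)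
  also have "\<dots> = 27/256" using assms by (simp add: loop_weight_def)
  finally show ?thesis .
qed

text \<open>
  By \<open>earlier_neighbour_differs\<close> at most one place other than 1 fits. If place 1 fits too, the
  pattern contains the vertex \<open>0\<close>, so that the other place belongs to a neighbour of \<open>0\<close>.
\<close>

lemma loop_weight_le_1:
  assumes m: "6 \<le> m"
  defines "R \<equiv> \<lambda>j i. (loop_list (Suc m) ! j, loop_list (Suc m) ! i) \<in> parcs (double_loop_graph (Suc m))"
  shows "(\<Sum>i | i \<in> {1..m} \<and> fits R N i. loop_weight m i) \<le> 1"
proof -
  define S where "S = {i. i \<in> {1..m} \<and> fits R N i}"
  have R: "R j i \<longleftrightarrow> (int (loop_order j), int (loop_order i)) \<in> parcs (double_loop_graph (Suc m))"
    if "j \<le> m" "i \<le> m" for i j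
    using that by (simp add: R_def del: upt_Suc)
  have le: "\<not> i < i'" if "i \<in> S - {1}" "i' \<in> S - {1}" for i i'
  proof
    assume "i < i'"
    have i: "2 \<le> i" "i' \<le> m" using that by (auto simp: S_def)
    obtain j where j: "j < i" "((int (loop_order j), int (loop_order i)) \<in> parcs (double_loop_graph (Suc m)))
        \<noteq> ((int (loop_order j), int (loop_order i')) \<in> parcs (double_loop_graph (Suc m)))"
      using earlier_neighbour_differs[OF m i(1) \<open>i < i'\<close> i(2)] by blast
    then have "R j i \<noteq> R j i'" using i \<open>i < i'\<close> by (simp add: R)
    moreover have "N j = R j i" "N j = R j i'" using that j \<open>i < i'\<close> by (auto simp: S_def fits_def)
    ultimately show False by simp
  qed
  have uniq: "i = i'" if "i \<in> S - {1}" "i' \<in> S - {1}" for i i'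
    using le[OF that] le[OF that(2,1)] by simp
  have "(\<Sum>i\<in>S. loop_weight m i) \<le> 1"
  proof (cases "S - {1} = {}")
    case True
    then have "S = {} \<or> S = {1}" by blast
    then show ?thesis by (auto simp: loop_weight_def)
  next
    case False
    then obtain x where x: "x \<in> S - {1}" by blast
    then have S: "S - {1} = {x}" using uniq by blast
    show ?thesis
    proof (cases "1 \<in> S")
      case True
      have "R 0 x"
      proof -
        have "N 0 = R 0 1" "N 0 = R 0 x" using True x by (auto simp: S_def fits_def)
        moreover have "R 0 1"
          using m by (subst R, simp, simp, subst double_loop_graph_arc_iff) (simp_all add: loop_order_def)
        ultimately show ?thesis by simp
      qed
      moreover have "2 \<le> x" "x \<le> m" using x by (auto simp: S_def)
      ultimately have "x \<in> {2, m - 1, m}"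
        using m double_loop_graph_arc_iff[of "Suc m" "loop_order 0" "loop_order x"]
        by (auto simp: R loop_order_def split: if_splits)
      moreover have "S = {1, x}" "x \<noteq> 1" using True S x by auto
      ultimately show ?thesis using m by (simp add: loop_weight_def)
    next
      case False
      then have "S = {x}" using S by auto
      then show ?thesis by (simp add: loop_weight_def)
    qed
  qed
  then show ?thesis by (simp only: S_def)
qed

lemma rotations_are_automorphisms:
  assumes k: "5 \<le> k"
  shows "k \<le> card (embeddings (loop_list k) (double_loop_graph k) (double_loop_graph k))"
proof -
  let ?H = "double_loop_graph k" and ?hs = "loop_list k"
  let ?rot = "\<lambda>r. map (\<lambda>a. (a + int r) mod int k) ?hs"
  have "?rot r \<in> embeddings ?hs ?H ?H" for r
  proof -
    have "inj_on (\<lambda>a. (a + int r) mod int k) {0..<int k}"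
    proof (rule inj_onI)
      fix a b assume ab: "a \<in> {0..<int k}" "b \<in> {0..<int k}" "(a + int r) mod int k = (b + int r) mod int k"
      then have "[a = b] (mod int k)" by (simp add: cong_def[symmetric] cong_add_rcancel)
      then show "a = b" using ab by (simp add: cong_def)
    qed
    moreover have "set ?hs \<subseteq> {0..<int k}" using k by (auto simp: loop_order_less)
    moreover have "distinct ?hs" by (simp add: distinct_map inj_on_def loop_order_eq_iff)
    ultimately have "distinct (?rot r)" unfolding distinct_map by (meson inj_on_subset)
    moreover have "set (?rot r) \<subseteq> pverts ?H" using k by (auto simp: double_loop_graph_def)
    moreover have "((a + int r) mod int k, (b + int r) mod int k) \<in> parcs ?H \<longleftrightarrow> (a, b) \<in> parcs ?H"
      if "a \<in> {0..<int k}" "b \<in> {0..<int k}" for a b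
    proof -
      have plus: "[(b + int r) mod int k = (a + int r) mod int k + d] (mod int k) \<longleftrightarrow> [b = a + d] (mod int k)" for d
      proof -
        have "[(b + int r) mod int k = (a + int r) mod int k + d] (mod int k)
            \<longleftrightarrow> [b + int r = (a + int r) + d] (mod int k)"
          by (simp only: cong_def mod_add_left_eq mod_mod_trivial)
        also have "\<dots> \<longleftrightarrow> [b + int r = (a + d) + int r] (mod int k)" by (simp only: add_ac)
        also have "\<dots> \<longleftrightarrow> [b = a + d] (mod int k)" by (rule cong_add_rcancel)
        finally show ?thesis .
      qed
      have minus: "[(b + int r) mod int k = (a + int r) mod int k - d] (mod int k) \<longleftrightarrow> [b = a - d] (mod int k)" for d
        using plus[of "- d"] by (simp only: diff_conv_add_uminus)
      have arc: "(x, y) \<in> parcs ?H \<longleftrightarrow> (\<exists>d\<in>{1, 2}. [y = x + d] (mod int k) \<or> [y = x - d] (mod int k))"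
        if "x \<in> {0..<int k}" "y \<in> {0..<int k}" for x y
        using that by (simp add: double_loop_graph_def)
      have "(x + int r) mod int k \<in> {0..<int k}" for x using k by simp
      then show ?thesis using that by (simp only: arc plus minus)
    qed
    ultimately show ?thesis using k by (auto simp: embeddings_def loop_order_less)
  qed
  moreover have "inj_on ?rot {..<k}"
  proof (rule inj_onI)
    fix r s assume rs: "r \<in> {..<k}" "s \<in> {..<k}" "?rot r = ?rot s"
    then have "?rot r ! 0 = ?rot s ! 0" by simp
    then show "r = s" using rs(1,2) k by (simp add: loop_order_def)
  qed
  moreover have "finite (embeddings ?hs ?H ?H)"
    by (rule finite_embeddings) (simp add: double_loop_graph_def)
  ultimately have "card {..<k} \<le> card (embeddings ?hs ?H ?H)"
    by (intro card_inj_on_le[of ?rot]) auto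
  then show ?thesis by simp
qed

section \<open>Order six: the octahedron\<close>

text \<open>
  In the double loop graph of order 6 only antipodal vertices are non-adjacent, so it is the complete
  tripartite graph whose classes are the residues modulo 3.
\<close>

lemma octahedron_arc_iff:
  assumes "a \<in> {0..<6}" "b \<in> {0..<6}"
  shows "(a, b) \<in> parcs (double_loop_graph 6) \<longleftrightarrow> a mod 3 \<noteq> b mod 3"
proof -
  obtain i j where ij: "a = int i" "b = int j" using assms by (metis atLeastLessThan_iff nonneg_int_cases)
  then have less: "i < 6" "j < 6" and ij_in: "i \<in> {0, 1, 2, 3, 4, 5}" "j \<in> {0, 1, 2, 3, 4, 5}" using assms by auto
  have all: "\<forall>i\<in>{0, 1, 2, 3, 4, 5::nat}. \<forall>j\<in>{0, 1, 2, 3, 4, 5::nat}.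
     (j = i + 1 \<or> j = i + 2 \<or> i = j + 1 \<or> i = j + 2 \<or>
      j + 6 = i + 1 \<or> j + 6 = i + 2 \<or> i + 6 = j + 1 \<or> i + 6 = j + 2) = (i mod 3 \<noteq> j mod 3)"
    by simp
  have "(int i, int j) \<in> parcs (double_loop_graph 6) \<longleftrightarrow>
     (j = i + 1 \<or> j = i + 2 \<or> i = j + 1 \<or> i = j + 2 \<or>
      j + 6 = i + 1 \<or> j + 6 = i + 2 \<or> i + 6 = j + 1 \<or> i + 6 = j + 2)"
    by (rule double_loop_graph_arc_iff[OF _ less]) simp
  also have "\<dots> \<longleftrightarrow> i mod 3 \<noteq> j mod 3"
    by (rule all[rule_format, OF ij_in])
  finally have "(int i, int j) \<in> parcs (double_loop_graph 6) \<longleftrightarrow> i mod 3 \<noteq> j mod 3" .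
  moreover have "int x mod 3 = int (x mod 3)" for x by (simp add: zmod_int)
  ultimately show ?thesis unfolding ij by (simp only: of_nat_eq_iff)
qed

text \<open>
  The parameter \<open>r\<close> permutes the three classes cyclically, and \<open>s\<close> tells in which of them the two
  vertices are exchanged. These are half of the 48 automorphisms, which is more than the 21 that the
  final estimate needs.
\<close>

definition octahedron_automorphisms :: "int list list" where
  "octahedron_automorphisms =
     [map (\<lambda>a. (a + r + s ! nat (a mod 3)) mod 6) [0, 2, 1, 3, 4, 5].
       r \<leftarrow> [0, 1, 2], s \<leftarrow> product_lists (replicate 3 [0, 3])]"

lemma octahedron_automorphisms_eval:
  "distinct octahedron_automorphisms \<and> length octahedron_automorphisms = 24 \<and>
   (\<forall>p\<in>set octahedron_automorphisms. length p = 6 \<and> distinct p \<and> list_all (\<lambda>a. 0 \<le> a \<and> a < 6) p \<and>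
     list_all (\<lambda>i. list_all (\<lambda>j.
       (p ! i mod 3 = p ! j mod 3) = ([0, 2, 1, 3, 4, 5::int] ! i mod 3 = [0, 2, 1, 3, 4, 5] ! j mod 3)) [0..<6]) [0..<6])"
  by code_simp

lemma loop_list_6: "loop_list 6 = [0, 2, 1, 3, 4, 5]"
  by (simp add: loop_order_def upt_rec)

lemma octahedron_automorphisms_card:
  "24 \<le> card (embeddings (loop_list 6) (double_loop_graph 6) (double_loop_graph 6))"
proof -
  let ?H = "double_loop_graph 6" and ?hs = "[0, 2, 1, 3, 4, 5::int]"
  have "p \<in> embeddings ?hs ?H ?H" if "p \<in> set octahedron_automorphisms" for p
  proof -
    have p: "length p = 6" "distinct p" "\<And>a. a \<in> set p \<Longrightarrow> a \<in> {0..<6}"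
      "\<And>i j. i < 6 \<Longrightarrow> j < 6 \<Longrightarrow> (p ! i mod 3 = p ! j mod 3) = (?hs ! i mod 3 = ?hs ! j mod 3)"
      using octahedron_automorphisms_eval that by (auto simp: list_all_iff)
    have "?hs ! i \<in> {0..<6}" if "i < 6" for i
    proof -
      have "?hs ! i \<in> set ?hs" using that by (intro nth_mem) simp
      then show ?thesis by auto
    qed
    moreover have "p ! i \<in> {0..<6}" if "i < 6" for i using p(1,3) that by simp
    ultimately have "(p ! i, p ! j) \<in> parcs ?H \<longleftrightarrow> (?hs ! i, ?hs ! j) \<in> parcs ?H" if "i < 6" "j < 6" for i j
      using p(4) that by (simp only: octahedron_arc_iff)
    then show ?thesis using p(1-3) by (auto simp: embeddings_def double_loop_graph_def)
  qed
  then have "card (set octahedron_automorphisms) \<le> card (embeddings ?hs ?H ?H)"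
    by (intro card_mono finite_embeddings) (auto simp: double_loop_graph_def)
  then show ?thesis
    using octahedron_automorphisms_eval unfolding loop_list_6 by (simp add: distinct_card)
qed

text \<open>
  The only candidate sets that have a vertex in common are those of the places 1, 2, 4 and those of
  the places 1, 5; in both cases the weights add up to 1.
\<close>

definition octahedron_weight :: "nat \<Rightarrow> real" where
  "octahedron_weight i = (if i = 1 then 1/4 else if i = 3 then 1 else if i = 5 then 3/4 else 3/8)"

lemma octahedron_weight_le_1:
  "(\<Sum>i | i \<in> {1..5} \<and> fits (\<lambda>j i. (loop_list 6 ! j, loop_list 6 ! i) \<in> parcs (double_loop_graph 6)) N i.
     octahedron_weight i) \<le> 1"
proof -
  have e: "{1..5} = {1, 2, 3, 4, 5::nat}" by auto
  let ?R = "\<lambda>j i. (loop_list 6 ! j, loop_list 6 ! i) \<in> parcs (double_loop_graph 6)"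
  have all_less: "(\<forall>j<1. P j) \<longleftrightarrow> P 0" "(\<forall>j<2. P j) \<longleftrightarrow> P 0 \<and> P 1" "(\<forall>j<3. P j) \<longleftrightarrow> P 0 \<and> P 1 \<and> P 2"
    "(\<forall>j<4. P j) \<longleftrightarrow> P 0 \<and> P 1 \<and> P 2 \<and> P 3" "(\<forall>j<5. P j) \<longleftrightarrow> P 0 \<and> P 1 \<and> P 2 \<and> P 3 \<and> P 4"
    for P :: "nat \<Rightarrow> bool"
    by (auto simp: numeral_eq_Suc less_Suc_eq)
  have "fits ?R N 1 \<longleftrightarrow> N 0" "fits ?R N 2 \<longleftrightarrow> N 0 \<and> N 1" "fits ?R N 3 \<longleftrightarrow> \<not> N 0 \<and> N 1 \<and> N 2"
    "fits ?R N 4 \<longleftrightarrow> N 0 \<and> N 1 \<and> \<not> N 2 \<and> N 3"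
    "fits ?R N 5 \<longleftrightarrow> N 0 \<and> \<not> N 1 \<and> N 2 \<and> N 3 \<and> N 4"
    unfolding loop_list_6 fits_def all_less by (simp_all add: octahedron_arc_iff)
  then have "(\<Sum>i\<in>{1..5}. if fits ?R N i then octahedron_weight i else 0) \<le> 1"
    unfolding e by (auto simp: octahedron_weight_def)
  then show ?thesis by (simp only: sum.inter_filter finite_atLeastAtMost)
qed

section \<open>The bound for all orders\<close>

lemma wf_double_loop_graph:
  assumes "5 \<le> k"
  shows "pair_wf_digraph (double_loop_graph k)"
proof -
  interpret pair_graph "double_loop_graph k" using assms by (rule pair_graph_double_loop_graph)
  show ?thesis by (rule pair_wf_digraph_axioms)
qed

lemma card_pverts_double_loop_graph: "card (pverts (double_loop_graph k)) = k"
  by (simp add: double_loop_graph_def)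

lemma inducibility_at_le_1: "inducibility_at H n \<le> 1"
proof -
  obtain G :: "nat pair_pre_digraph" where G: "pair_graph G" "card (pverts G) = n"
    and eq: "count_induced H G = max_induced H n"
    by (rule max_induced_attained)
  interpret pair_graph G by (fact G(1))
  have "max_induced H n \<le> n choose card (pverts H)"
    using count_induced_le[OF pair_finite_verts] G eq by metis
  then show ?thesis by (simp add: inducibility_at_def divide_le_eq_1) linarith
qed

lemma inducibility_le_1: "inducibility H \<le> 1"
  by (rule LIMSEQ_le_const2[OF inducibility_at_LIMSEQ]) (simp add: inducibility_at_le_1)

lemma power_Suc_ratio_le: "m > 0 \<Longrightarrow> real (Suc m) ^ m \<le> 729/256 * real m ^ m"
proof -
  assume m: "m > 0"
  have "(1 + 1 / real m) ^ m \<le> exp 1"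
    using m by (intro exp_ge_one_plus_x_over_n_power_n) auto
  also have "\<dots> \<le> 729/256" using e_less_272 by simp
  finally have "(real (Suc m) / real m) ^ m \<le> 729/256"
    using m by (simp add: field_simps)
  then show ?thesis using m by (simp add: power_divide pos_divide_le_eq)
qed

theorem lemma2:
  fixes k :: nat
  assumes "k \<ge> 5"
  shows "inducibility (double_loop_graph k) \<le> 27 * fact k / real k ^ k"
proof -
  let ?H = "double_loop_graph k"
  consider "k = 5" | "k = 6" | "7 \<le> k" using assms by linarith
  then show ?thesis
  proof cases
    case 1
    \<comment> \<open>The right-hand side is \<open>3240/3125\<close>.\<close>
    have "1 \<le> 27 * fact 5 / (5 ^ 5 :: real)" by (simp add: fact_numeral)
    then show ?thesis using inducibility_le_1[of ?H] 1 by simp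
  next
    case 2
    have wf: "pair_wf_digraph (double_loop_graph 6)" by (rule wf_double_loop_graph) simp
    have "{1..5} = {1, 2, 3, 4, 5::nat}" by auto
    then have "(\<Prod>i=1..5. octahedron_weight i) = 27/1024"
      by (simp only:) (simp add: octahedron_weight_def)
    moreover have "inducibility (double_loop_graph 6)
        \<le> fact (Suc 5) / (real 24 * (\<Prod>i=1..5. octahedron_weight i) * real 5 ^ 5)"
      by (rule inducibility_le_of_weights[OF wf _ _ _ _ octahedron_automorphisms_card _ octahedron_weight_le_1])
        (simp_all add: card_pverts_double_loop_graph octahedron_weight_def)
    ultimately have "inducibility (double_loop_graph 6) \<le> fact (Suc 5) / (real 24 * (27/1024) * real 5 ^ 5)"
      by (simp only:)
    also have "\<dots> \<le> 27 * fact 6 / 6 ^ 6" by (simp add: fact_numeral)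
    finally show ?thesis using 2 by simp
  next
    case 3
    define m where "m = k - 1"
    have m: "6 \<le> m" "k = Suc m" using 3 by (auto simp: m_def)
    have "inducibility ?H \<le> fact (Suc m) / (real k * (\<Prod>i=1..m. loop_weight m i) * real m ^ m)"
    proof (rule inducibility_le_of_weights)
      show "pair_wf_digraph ?H" using assms by (rule wf_double_loop_graph)
      show "k \<le> card (embeddings (loop_list k) ?H ?H)" using assms by (rule rotations_are_automorphisms)
      show "(\<Sum>i | i \<in> {1..m} \<and> fits (\<lambda>j i. (loop_list k ! j, loop_list k ! i) \<in> parcs ?H) N i. loop_weight m i) \<le> 1" for N
        using loop_weight_le_1[OF m(1)] unfolding m(2) .
    qed (use m in \<open>simp_all add: card_pverts_double_loop_graph loop_weight_def\<close>)
    also have "\<dots> = fact k / (real k * (27/256) * real m ^ m)"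
      by (simp only: prod_loop_weight[OF m(1)] m(2))
    also have "\<dots> \<le> 27 * fact k / real k ^ k"
    proof -
      have "real k ^ k = real k * real k ^ m" by (simp add: m(2))
      also have "\<dots> \<le> real k * (729/256 * real m ^ m)"
        using power_Suc_ratio_le[of m] m by (intro mult_left_mono) auto
      finally have le: "real k ^ k \<le> real k * (729/256 * real m ^ m)" .
      have "fact k / (real k * (27/256) * real m ^ m) = 27 * fact k / (real k * (729/256 * real m ^ m))"
        by simp
      also have "\<dots> \<le> 27 * fact k / real k ^ k"
        using le m by (intro divide_left_mono) auto
      finally show ?thesis .
    qed
    finally show ?thesis .
  qed
qed

end
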